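(* Let $G$ be a topological group with trivial center $\{t\in G\mid tg=gt\ \forall g\in G\}=\{e\}$, and let $(G,\Pi(G))$ be its universal minimal proximal flow. Then the following statements are pairwise equivalent: (1) $(G,\Pi(G))$ is effective; (2) the map $t\mapsto\widehat{\sigma_t}$ from $G$ to $\mathrm{Homeo}(\Pi(G))$ is one-to-one; (3) the map $a\mapsto\hat a$ from $\mathrm{Aut}(G)$ to $\mathrm{Homeo}(\Pi(G))$ is one-to-one. Hence, if one of (1), (2), (3) holds, then the universal minimal flow $(G,\mathrm{M}(G))$ of $G$ is effective.
   Context: A topological group is a group with a Hausdorff topology such that $(x,y)\mapsto xy^{-1}$ is continuous; $e$ is its neutral element. A flow $(G,X)$ consists of a topological group $G$ and a (nonempty) compact Hausdorff space $X$ with a jointly continuous action $G\times X\to X$, $(t,x)\mapsto tx$. A flow is effective if $tx=x$ for all $x\in X$ implies $t=e$; minimal if every orbit is dense; proximal if for all $x,y\in X$ there is a net $\{t_n\}$ in $G$ with $\lim t_nx=\lim t_ny$. The universal minimal flow $(G,\mathrm{M}(G))$ (respectively universal minimal proximal flow $(G,\Pi(G))$) is the minimal (respectively minimal proximal) flow, unique up to isomorphism, having every minimal (respectively minimal proximal) flow of $G$ as a factor, i.e. as the image under a continuous surjective $G$-equivariant map; existence and uniqueness are known. $\mathrm{Aut}(G)$ is the group of topological automorphisms of $G$, $\mathrm{Homeo}(\Pi(G))$ is the group of self-homeomorphisms of $\Pi(G)$, and $\sigma_t\in\mathrm{Aut}(G)$ is the inner automorphism $\sigma_t(g)=tgt^{-1}$.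 It is known (Furstenberg) that for each $a\in\mathrm{Aut}(G)$ there is a unique homeomorphism $\hat a$ of $\Pi(G)$ satisfying $\hat a(tx)=a(t)\hat a(x)$ for all $t\in G$, $x\in\Pi(G)$; the map $a\mapsto\hat a$ is a group homomorphism $\mathrm{Aut}(G)\to\mathrm{Homeo}(\Pi(G))$, and $\widehat{\sigma_t}(x)=tx$. *)

theory Defs
  imports "HOL-Analysis.Analysis" "HOL-Algebra.Group_Action"
begin

no_notation eq_closure_of ("closure'_of\<index>")

locale topological_group = group G for G :: "('g, 'r) monoid_scheme" (structure) +
  fixes T :: "'g topology"
  assumes topspace_eq_carrier: "topspace T = carrier G"
    and Hausdorff_group: "Hausdorff_space T"
    and continuous_mult_inv: "continuous_map (prod_topology T T) T (\<lambda>(x, y). x \<otimes> inv y)"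

text \<open>
  By the definition of \<open>group_action\<close>, each \<open>\<phi> t\<close> is an extensional function, i.e. it is
  \<open>undefined\<close> outside \<open>topspace X\<close>; only its values on \<open>topspace X\<close> carry information.
\<close>

locale flow = topological_group G T + group_action G "topspace X" \<phi>
  for G :: "('g, 'r) monoid_scheme" (structure) and T
    and X :: "'x topology" and \<phi> :: "'g \<Rightarrow> 'x \<Rightarrow> 'x" +
  assumes nonempty_space: "topspace X \<noteq> {}"
    and compact_phase_space: "compact_space X"
    and Hausdorff_phase_space: "Hausdorff_space X"
    and continuous_action: "continuous_map (prod_topology T X) X (\<lambda>(t, x). \<phi> t x)"

definition effective :: "('g, 'r) monoid_scheme \<Rightarrow> 'x topology \<Rightarrow> ('g \<Rightarrow> 'x \<Rightarrow> 'x) \<Rightarrow> bool" where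
  "effective G X \<phi> \<longleftrightarrow>
    (\<forall>t\<in>carrier G. (\<forall>x\<in>topspace X. \<phi> t x = x) \<longrightarrow> t = \<one>\<^bsub>G\<^esub>)"

definition minimal_flow ::
  "('g, 'r) monoid_scheme \<Rightarrow> 'g topology \<Rightarrow> 'x topology \<Rightarrow> ('g \<Rightarrow> 'x \<Rightarrow> 'x) \<Rightarrow> bool" where
  "minimal_flow G T X \<phi> \<longleftrightarrow> flow G T X \<phi> \<and>
    (\<forall>x\<in>topspace X. X closure_of (orbit G \<phi> x) = topspace X)"

text \<open>
  A net in \<open>G\<close> is represented, as usual in HOL, by a proper filter containing \<open>carrier G\<close>
  (the filter generated by the tails of the net).
\<close>

definition proximal ::
  "('g, 'r) monoid_scheme \<Rightarrow> 'x topology \<Rightarrow> ('g \<Rightarrow> 'x \<Rightarrow> 'x) \<Rightarrow> bool" where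
  "proximal G X \<phi> \<longleftrightarrow>
    (\<forall>x\<in>topspace X. \<forall>y\<in>topspace X. \<exists>F z. F \<noteq> bot \<and> (\<forall>\<^sub>F t in F. t \<in> carrier G) \<and>
       limitin X (\<lambda>t. \<phi> t x) z F \<and> limitin X (\<lambda>t. \<phi> t y) z F)"

definition minimal_proximal_flow ::
  "('g, 'r) monoid_scheme \<Rightarrow> 'g topology \<Rightarrow> 'x topology \<Rightarrow> ('g \<Rightarrow> 'x \<Rightarrow> 'x) \<Rightarrow> bool" where
  "minimal_proximal_flow G T X \<phi> \<longleftrightarrow> minimal_flow G T X \<phi> \<and> proximal G X \<phi>"

text \<open>\<open>is_factor G Y \<psi> X \<phi>\<close>: the flow \<open>(G, Y)\<close> is a factor of the flow \<open>(G, X)\<close>.\<close>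

definition is_factor ::
  "('g, 'r) monoid_scheme \<Rightarrow> 'y topology \<Rightarrow> ('g \<Rightarrow> 'y \<Rightarrow> 'y) \<Rightarrow>
   'x topology \<Rightarrow> ('g \<Rightarrow> 'x \<Rightarrow> 'x) \<Rightarrow> bool" where
  "is_factor G Y \<psi> X \<phi> \<longleftrightarrow>
    (\<exists>p. continuous_map X Y p \<and> p ` topspace X = topspace Y \<and>
         (\<forall>t\<in>carrier G. \<forall>x\<in>topspace X. p (\<phi> t x) = \<psi> t (p x)))"

text \<open>
  HOL cannot quantify over types inside a formula, so the flows in the universal property below
  live on subsets of the type \<open>'g set set\<close>. This is no restriction: a Hausdorff space with a
  dense subset indexed by \<open>G\<close> embeds as a set into the double power set of \<open>G\<close>, so every minimal
  flow of \<open>G\<close>, on whatever type, has an isomorphic copy of that kind. The lemmas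
  \<open>universal_minimal_flow_factor\<close> and \<open>universal_minimal_proximal_flow_factor\<close> below derive
  the universal property for flows on arbitrary types.
\<close>

definition universal_minimal_flow ::
  "('g, 'r) monoid_scheme \<Rightarrow> 'g topology \<Rightarrow> 'x topology \<Rightarrow> ('g \<Rightarrow> 'x \<Rightarrow> 'x) \<Rightarrow> bool" where
  "universal_minimal_flow G T M \<phi> \<longleftrightarrow> minimal_flow G T M \<phi> \<and>
    (\<forall>(Y :: 'g set set topology) \<psi>. minimal_flow G T Y \<psi> \<longrightarrow> is_factor G Y \<psi> M \<phi>)"

definition universal_minimal_proximal_flow ::
  "('g, 'r) monoid_scheme \<Rightarrow> 'g topology \<Rightarrow> 'x topology \<Rightarrow> ('g \<Rightarrow> 'x \<Rightarrow> 'x) \<Rightarrow> bool" where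
  "universal_minimal_proximal_flow G T P \<phi> \<longleftrightarrow> minimal_proximal_flow G T P \<phi> \<and>
    (\<forall>(Y :: 'g set set topology) \<psi>. minimal_proximal_flow G T Y \<psi> \<longrightarrow> is_factor G Y \<psi> P \<phi>)"

text \<open>
  Automorphisms and self-homeomorphisms are extensional functions, so that equality of
  functions is equality on \<open>carrier G\<close> and on \<open>topspace X\<close>, respectively.
\<close>

definition Aut :: "('g, 'r) monoid_scheme \<Rightarrow> 'g topology \<Rightarrow> ('g \<Rightarrow> 'g) set" where
  "Aut G T = {a \<in> auto G. homeomorphic_map T T a}"

definition Homeo :: "'x topology \<Rightarrow> ('x \<Rightarrow> 'x) set" where
  "Homeo X = {h \<in> Bij (topspace X). homeomorphic_map X X h}"

definition inner_aut :: "('g, 'r) monoid_scheme \<Rightarrow> 'g \<Rightarrow> 'g \<Rightarrow> 'g" where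
  "inner_aut G t = (\<lambda>g\<in>carrier G. t \<otimes>\<^bsub>G\<^esub> g \<otimes>\<^bsub>G\<^esub> inv\<^bsub>G\<^esub> t)"

text \<open>
  Existence and uniqueness of \<open>hat G P \<phi> a\<close> are guaranteed (Furstenberg) when \<open>(G, P)\<close> is the
  universal minimal proximal flow and \<open>a \<in> Aut G T\<close>.
\<close>

definition hat ::
  "('g, 'r) monoid_scheme \<Rightarrow> 'x topology \<Rightarrow> ('g \<Rightarrow> 'x \<Rightarrow> 'x) \<Rightarrow> ('g \<Rightarrow> 'g) \<Rightarrow> 'x \<Rightarrow> 'x" where
  "hat G P \<phi> a = (THE h. h \<in> Homeo P \<and>
     (\<forall>t\<in>carrier G. \<forall>x\<in>topspace P. h (\<phi> t x) = \<phi> (a t) (h x)))"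

lemma minimal_flow_embeds:
  fixes Y :: "'y topology" and G :: "('g, 'r) monoid_scheme"
  assumes "minimal_flow G T Y \<psi>"
  obtains f :: "'y \<Rightarrow> 'g set set" where "inj_on f (topspace Y)"
proof -
  interpret flow G T Y \<psi> using assms by (simp add: minimal_flow_def)
  obtain x0 where x0: "x0 \<in> topspace Y" using nonempty_space by blast
  have dense: "Y closure_of (orbit G \<psi> x0) = topspace Y"
    using assms x0 by (simp add: minimal_flow_def)
  define f where "f y = {A. A \<subseteq> carrier G \<and> y \<in> Y closure_of ((\<lambda>t. \<psi> t x0) ` A)}" for y
  have "inj_on f (topspace Y)"
  proof (rule inj_onI, rule ccontr)
    fix x y assume xy: "x \<in> topspace Y" "y \<in> topspace Y" "f x = f y" "x \<noteq> y"
    obtain U V where UV: "openin Y U" "openin Y V" "x \<in> U" "y \<in> V" "disjnt U V"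
      using Hausdorff_phase_space xy unfolding Hausdorff_space_def by metis
    define A where "A = {t \<in> carrier G. \<psi> t x0 \<in> U}"
    have "x \<in> Y closure_of ((\<lambda>t. \<psi> t x0) ` A)"
      unfolding in_closure_of
    proof (intro conjI allI impI)
      fix W assume W: "x \<in> W \<and> openin Y W"
      have "x \<in> Y closure_of (orbit G \<psi> x0)" using dense xy by simp
      moreover have "openin Y (U \<inter> W)" "x \<in> U \<inter> W" using UV W by auto
      ultimately obtain z where "z \<in> orbit G \<psi> x0" "z \<in> U \<inter> W"
        unfolding in_closure_of by blast
      then show "\<exists>y. y \<in> (\<lambda>t. \<psi> t x0) ` A \<and> y \<in> W"
        unfolding orbit_def A_def by blast
    qed (use xy in auto)
    then have "A \<in> f x" by (simp add: f_def A_def)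
    then have "A \<in> f y" using xy by simp
    then have "y \<in> Y closure_of ((\<lambda>t. \<psi> t x0) ` A)" by (simp add: f_def)
    then obtain z where "z \<in> (\<lambda>t. \<psi> t x0) ` A" "z \<in> V"
      using UV unfolding in_closure_of by blast
    then show False using UV(5) by (auto simp: A_def disjnt_iff)
  qed
  then show thesis by (rule that)
qed

lemma flow_transport:
  fixes Y :: "'y topology" and f :: "'y \<Rightarrow> 'z" and G :: "('g, 'r) monoid_scheme"
  assumes "flow G T Y \<psi>" and inj: "inj_on f (topspace Y)"
  obtains Z \<zeta> g where "flow G T Z \<zeta>" "homeomorphic_maps Y Z f g"
    "\<And>t y. t \<in> carrier G \<Longrightarrow> y \<in> topspace Y \<Longrightarrow> f (\<psi> t y) = \<zeta> t (f y)"
proof -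
  interpret flow G T Y \<psi> by fact
  define S where "S = topspace Y"
  define g where "g = inv_into S f"
  define Z where "Z = pullback_topology (f ` S) g Y"
  define \<zeta> where "\<zeta> t = (\<lambda>z\<in>f ` S. f (\<psi> t (g z)))" for t
  have gf: "g (f y) = y" if "y \<in> S" for y using inj that by (simp add: g_def S_def)
  have tZ: "topspace Z = f ` S"
    using gf by (auto simp: Z_def topspace_pullback_topology S_def)
  have closed: "\<psi> t y \<in> S" if "t \<in> carrier G" "y \<in> S" for t y
    using element_image that by (simp add: S_def)
  have cg: "continuous_map Z Y g" unfolding Z_def
    by (metis continuous_map_id continuous_map_pullback id_comp comp_id)
  have cf: "continuous_map Y Z f" unfolding Z_def
  proof (rule continuous_map_pullback')
    show "continuous_map Y Y (g \<circ> f)"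
      by (rule continuous_map_eq[OF continuous_map_id]) (simp add: gf S_def)
  qed (auto simp: S_def)
  have hm: "homeomorphic_maps Y Z f g"
    unfolding homeomorphic_maps_def using cf cg gf tZ by (auto simp: S_def)
  have \<zeta>f: "\<zeta> t (f y) = f (\<psi> t y)" if "y \<in> S" for t y using that gf by (simp add: \<zeta>_def)
  have \<zeta>Z: "\<zeta> t z \<in> f ` S" if "t \<in> carrier G" "z \<in> f ` S" for t z
    using that \<zeta>f closed by auto
  have mult: "\<zeta> (s \<otimes>\<^bsub>G\<^esub> t) z = \<zeta> s (\<zeta> t z)"
    if "s \<in> carrier G" "t \<in> carrier G" "z \<in> f ` S" for s t z
    using that closed composition_rule by (auto simp: \<zeta>f S_def)
  have one: "\<zeta> \<one>\<^bsub>G\<^esub> z = z" if "z \<in> f ` S" for z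
    using that id_eq_one by (auto simp: \<zeta>f S_def dest: fun_cong)
      (metis restrict_apply')
  have bij: "\<zeta> t \<in> Bij (f ` S)" if t: "t \<in> carrier G" for t
  proof -
    have "bij_betw (\<zeta> t) (f ` S) (f ` S)"
    proof (rule bij_betw_byWitness[where f' = "\<zeta> (inv\<^bsub>G\<^esub> t)"])
      show "\<forall>z\<in>f ` S. \<zeta> (inv\<^bsub>G\<^esub> t) (\<zeta> t z) = z"
        using t mult[of "inv\<^bsub>G\<^esub> t" t] one by auto
      show "\<forall>z\<in>f ` S. \<zeta> t (\<zeta> (inv\<^bsub>G\<^esub> t) z) = z"
        using t mult[of t "inv\<^bsub>G\<^esub> t"] one by auto
    qed (use t \<zeta>Z in auto)
    then show ?thesis by (simp add: Bij_def \<zeta>_def)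
  qed
  have hom: "\<zeta> \<in> hom G (BijGroup (f ` S))"
  proof (rule homI)
    fix s t assume st: "s \<in> carrier G" "t \<in> carrier G"
    have "\<zeta> (s \<otimes>\<^bsub>G\<^esub> t) = compose (f ` S) (\<zeta> s) (\<zeta> t)"
    proof
      fix z show "\<zeta> (s \<otimes>\<^bsub>G\<^esub> t) z = compose (f ` S) (\<zeta> s) (\<zeta> t) z"
        using mult[OF st, of z] by (cases "z \<in> f ` S") (auto simp: compose_def \<zeta>_def)
    qed
    then show "\<zeta> (s \<otimes>\<^bsub>G\<^esub> t) = \<zeta> s \<otimes>\<^bsub>BijGroup (f ` S)\<^esub> \<zeta> t"
      using bij st by (simp add: BijGroup_def)
  qed (simp add: BijGroup_def bij)
  have act: "group_action G (topspace Z) \<zeta>"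
    unfolding tZ group_action_def group_hom_def group_hom_axioms_def
    using hom group_BijGroup is_group by blast
  have hs: "Y homeomorphic_space Z" using hm by (auto simp: homeomorphic_space_def)
  have "continuous_map (prod_topology T Z) Z (\<lambda>p. f ((\<lambda>(t, y). \<psi> t y) (fst p, g (snd p))))"
  proof -
    have "continuous_map (prod_topology T Z) (prod_topology T Y) (\<lambda>p. (fst p, g (snd p)))"
      by (intro continuous_map_pairedI continuous_map_fst
          continuous_map_compose[OF continuous_map_snd cg, unfolded o_def])
    then have "continuous_map (prod_topology T Z) Y ((\<lambda>(t, y). \<psi> t y) \<circ> (\<lambda>p. (fst p, g (snd p))))"
      by (rule continuous_map_compose[OF _ continuous_action])
    then have "continuous_map (prod_topology T Z) Z
        (f \<circ> ((\<lambda>(t, y). \<psi> t y) \<circ> (\<lambda>p. (fst p, g (snd p)))))"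
      by (rule continuous_map_compose[OF _ cf])
    then show ?thesis by (simp only: o_def)
  qed
  then have cact: "continuous_map (prod_topology T Z) Z (\<lambda>(t, z). \<zeta> t z)"
    by (rule continuous_map_eq) (auto simp: \<zeta>_def tZ)
  have "flow G T Z \<zeta>"
    unfolding flow_def flow_axioms_def
  proof (intro conjI)
    show "topological_group G T" by (rule topological_group_axioms)
    show "topspace Z \<noteq> {}" using nonempty_space by (simp add: tZ S_def)
    show "compact_space Z" using hs compact_phase_space homeomorphic_compact_space by blast
    show "Hausdorff_space Z" using hs Hausdorff_phase_space homeomorphic_Hausdorff_space by blast
  qed (use act cact in auto)
  with hm \<zeta>f show thesis by (intro that[of Z \<zeta> g]) (auto simp: S_def)
qed

lemma minimal_flow_copy:
  fixes Y :: "'y topology" and G :: "('g, 'r) monoid_scheme"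
  assumes min: "minimal_flow G T Y \<psi>"
  obtains Z :: "'g set set topology" and \<zeta> where "minimal_flow G T Z \<zeta>"
    "proximal G Y \<psi> \<Longrightarrow> proximal G Z \<zeta>"
    "\<And>(X :: 'x topology) \<phi>. is_factor G Z \<zeta> X \<phi> \<Longrightarrow> is_factor G Y \<psi> X \<phi>"
proof -
  obtain f :: "'y \<Rightarrow> 'g set set" where inj: "inj_on f (topspace Y)"
    using minimal_flow_embeds[OF min] by blast
  have flY: "flow G T Y \<psi>" using min by (simp add: minimal_flow_def)
  then interpret flow G T Y \<psi> .
  obtain Z \<zeta> g where fl: "flow G T Z \<zeta>" and hm: "homeomorphic_maps Y Z f g"
    and eq: "\<And>t y. t \<in> carrier G \<Longrightarrow> y \<in> topspace Y \<Longrightarrow> f (\<psi> t y) = \<zeta> t (f y)"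
    using flow_transport[OF flY inj] by blast
  have hf: "homeomorphic_map Y Z f" using hm homeomorphic_maps_map by blast
  have cf: "continuous_map Y Z f" and cg: "continuous_map Z Y g"
    and gf: "\<And>y. y \<in> topspace Y \<Longrightarrow> g (f y) = y" and fg: "\<And>z. z \<in> topspace Z \<Longrightarrow> f (g z) = z"
    using hm by (auto simp: homeomorphic_maps_def)
  have gZ: "g z \<in> topspace Y" if "z \<in> topspace Z" for z
    using continuous_map_image_subset_topspace[OF cg] that by auto
  have fY: "f y \<in> topspace Z" if "y \<in> topspace Y" for y
    using continuous_map_image_subset_topspace[OF cf] that by auto
  have closed: "\<psi> t y \<in> topspace Y" if "t \<in> carrier G" "y \<in> topspace Y" for t y
    using element_image that by simp
  have eqg: "g (\<zeta> t z) = \<psi> t (g z)" if "t \<in> carrier G" "z \<in> topspace Z" for t z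
    using eq[OF that(1) gZ[OF that(2)]] fg gf closed gZ that by metis
  have "minimal_flow G T Z \<zeta>"
    unfolding minimal_flow_def
  proof (intro conjI ballI fl)
    fix z assume z: "z \<in> topspace Z"
    have "orbit G \<zeta> z = f ` orbit G \<psi> (g z)"
      using eq[OF _ gZ[OF z]] fg[OF z] by (force simp: orbit_def image_iff)
    moreover have "orbit G \<psi> (g z) \<subseteq> topspace Y" using closed gZ[OF z] by (auto simp: orbit_def)
    ultimately have "Z closure_of orbit G \<zeta> z = f ` (Y closure_of orbit G \<psi> (g z))"
      using homeomorphic_map_closure_of[OF hf] by metis
    also have "\<dots> = topspace Z"
      using min gZ[OF z] homeomorphic_imp_surjective_map[OF hf] by (simp add: minimal_flow_def)
    finally show "Z closure_of orbit G \<zeta> z = topspace Z" .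
  qed
  moreover have "proximal G Z \<zeta>" if prox: "proximal G Y \<psi>"
    unfolding proximal_def
  proof (intro ballI)
    fix x y assume xy: "x \<in> topspace Z" "y \<in> topspace Z"
    obtain F z where F: "F \<noteq> bot" "\<forall>\<^sub>F t in F. t \<in> carrier G"
      "limitin Y (\<lambda>t. \<psi> t (g x)) z F" "limitin Y (\<lambda>t. \<psi> t (g y)) z F"
      using prox gZ[OF xy(1)] gZ[OF xy(2)] unfolding proximal_def by blast
    have lim: "limitin Z (\<lambda>t. \<zeta> t w) (f z) F"
      if "w \<in> topspace Z" "limitin Y (\<lambda>t. \<psi> t (g w)) z F" for w
    proof (rule limitin_transform_eventually)
      show "limitin Z (f \<circ> (\<lambda>t. \<psi> t (g w))) (f z) F"
        by (rule continuous_map_limit[OF cf that(2)])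
      show "\<forall>\<^sub>F t in F. (f \<circ> (\<lambda>t. \<psi> t (g w))) t = \<zeta> t w"
        using F(2) by eventually_elim (use eq gZ fg that in auto)
    qed
    show "\<exists>F z. F \<noteq> bot \<and> (\<forall>\<^sub>F t in F. t \<in> carrier G) \<and>
        limitin Z (\<lambda>t. \<zeta> t x) z F \<and> limitin Z (\<lambda>t. \<zeta> t y) z F"
      using lim[OF xy(1) F(3)] lim[OF xy(2) F(4)] F(1,2) by blast
  qed
  moreover have "is_factor G Y \<psi> X \<phi>" if factor: "is_factor G Z \<zeta> X \<phi>"
    for X :: "'x topology" and \<phi>
  proof -
    obtain p where p: "continuous_map X Z p" "p ` topspace X = topspace Z"
      "\<forall>t\<in>carrier G. \<forall>x\<in>topspace X. p (\<phi> t x) = \<zeta> t (p x)"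
      using factor unfolding is_factor_def by blast
    have "continuous_map X Y (g \<circ> p)" using p(1) cg continuous_map_compose by blast
    moreover have "(g \<circ> p) ` topspace X = topspace Y"
    proof -
      have "g ` topspace Z = topspace Y"
        using gZ gf fY by (metis image_eqI image_subsetI subsetI subset_antisym)
      then show ?thesis using p(2) by (metis image_comp)
    qed
    moreover have "\<forall>t\<in>carrier G. \<forall>x\<in>topspace X. (g \<circ> p) (\<phi> t x) = \<psi> t ((g \<circ> p) x)"
    proof (intro ballI)
      fix t x assume tx: "t \<in> carrier G" "x \<in> topspace X"
      then have "p x \<in> topspace Z" using p(2) by blast
      then show "(g \<circ> p) (\<phi> t x) = \<psi> t ((g \<circ> p) x)" using p(3) eqg tx by simp
    qed
    ultimately show ?thesis unfolding is_factor_def by blast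
  qed
  ultimately show thesis by (rule that)
qed

lemma universal_minimal_flow_factor:
  fixes G :: "('g, 'r) monoid_scheme" and M :: "'x topology" and Y :: "'y topology"
  assumes "universal_minimal_flow G T M \<phi>" "minimal_flow G T Y \<psi>"
  shows "is_factor G Y \<psi> M \<phi>"
proof -
  obtain Z :: "'g set set topology" and \<zeta> where Z: "minimal_flow G T Z \<zeta>"
    "\<And>(X :: 'x topology) \<phi>. is_factor G Z \<zeta> X \<phi> \<Longrightarrow> is_factor G Y \<psi> X \<phi>"
    by (rule minimal_flow_copy[OF assms(2)]) blast
  show ?thesis
    using assms(1) Z by (simp add: universal_minimal_flow_def)
qed

lemma universal_minimal_proximal_flow_factor:
  fixes G :: "('g, 'r) monoid_scheme" and P :: "'x topology" and Y :: "'y topology"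
  assumes "universal_minimal_proximal_flow G T P \<phi>" "minimal_proximal_flow G T Y \<psi>"
  shows "is_factor G Y \<psi> P \<phi>"
proof -
  have min: "minimal_flow G T Y \<psi>" and prox: "proximal G Y \<psi>"
    using assms(2) by (simp_all add: minimal_proximal_flow_def)
  obtain Z :: "'g set set topology" and \<zeta> where Z: "minimal_flow G T Z \<zeta>" "proximal G Z \<zeta>"
    "\<And>(X :: 'x topology) \<phi>. is_factor G Z \<zeta> X \<phi> \<Longrightarrow> is_factor G Y \<psi> X \<phi>"
    by (rule minimal_flow_copy[OF min]) (use prox in blast)
  show ?thesis
  proof (rule Z(3))
    show "is_factor G Z \<zeta> P \<phi>" using assms(1) Z(1,2)
      by (simp add: universal_minimal_proximal_flow_def minimal_proximal_flow_def)
  qed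
qed

end

theory Submission
  imports Defs
begin

text \<open>
  Equivariant maps from a minimal flow into a proximal flow are unique. Twisting the action on
  \<open>P\<close> by an automorphism \<open>a\<close> again gives a minimal proximal flow, so universality yields an
  equivariant map from \<open>P\<close> to its twist; the map obtained from the inverse of \<open>a\<close> inverts it by
  uniqueness, and this is the homeomorphism \<open>hat a\<close>. Uniqueness also identifies \<open>hat\<close> of the
  inner automorphism of \<open>t\<close> with the action of \<open>t\<close>, and an equality \<open>hat a = hat b\<close> says that
  \<open>a t\<close> and \<open>b t\<close> act in the same way for every \<open>t\<close>.
\<close>

section \<open>Uniqueness of equivariant maps into proximal flows\<close>

text \<open>Proximality pushes a pair of values \<open>(p u, q u)\<close> to the diagonal, and
  compactness turns the limit into a point where \<open>p\<close> and \<open>q\<close> agree. The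
  coincidence set is closed and contains the orbit of that point, so minimality makes it all of
  \<open>X\<close>.\<close>

lemma equivariant_maps_into_proximal_eq:
  assumes min: "minimal_flow G T X \<phi>" and flY: "flow G T Y \<psi>" and prox: "proximal G Y \<psi>"
    and cp: "continuous_map X Y p" and cq: "continuous_map X Y q"
    and ep: "\<And>t x. t \<in> carrier G \<Longrightarrow> x \<in> topspace X \<Longrightarrow> p (\<phi> t x) = \<psi> t (p x)"
    and eq: "\<And>t x. t \<in> carrier G \<Longrightarrow> x \<in> topspace X \<Longrightarrow> q (\<phi> t x) = \<psi> t (q x)"
    and x: "x \<in> topspace X"
  shows "p x = q x"
proof -
  interpret X: flow G T X \<phi> using min by (simp add: minimal_flow_def)
  interpret Y: flow G T Y \<psi> by (rule flY)
  define r where "r x = (p x, q x)" for x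
  have cr: "continuous_map X (prod_topology Y Y) r"
    unfolding r_def using cp cq by (intro continuous_map_pairedI)
  obtain u where u: "u \<in> topspace X" using X.nonempty_space by blast
  then have "p u \<in> topspace Y" "q u \<in> topspace Y"
    using cp cq continuous_map_image_subset_topspace by fast+
  then obtain F z where F: "F \<noteq> bot" "\<forall>\<^sub>F t in F. t \<in> carrier G"
    "limitin Y (\<lambda>t. \<psi> t (p u)) z F" "limitin Y (\<lambda>t. \<psi> t (q u)) z F"
    using prox unfolding proximal_def by blast
  \<comment> \<open>The image of \<open>r\<close> is compact, hence closed in the Hausdorff square
    of \<open>Y\<close>. By equivariance it contains the translates of \<open>(p u, q u)\<close>,
    hence also their limit on the diagonal.\<close>
  have "(z, z) \<in> r ` topspace X"
  proof (rule limitin_closedin)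
    show "limitin (prod_topology Y Y) (\<lambda>t. (\<psi> t (p u), \<psi> t (q u))) (z, z) F"
      using F(3,4) by (simp add: limitin_pairwise o_def)
    have "compactin (prod_topology Y Y) (r ` topspace X)"
      using image_compactin[OF _ cr] X.compact_phase_space by (simp add: compact_space_def)
    then show "closedin (prod_topology Y Y) (r ` topspace X)"
      by (intro compactin_imp_closedin)
        (simp_all add: Hausdorff_space_prod_topology Y.Hausdorff_phase_space)
    show "\<forall>\<^sub>F t in F. (\<psi> t (p u), \<psi> t (q u)) \<in> r ` topspace X"
      using F(2)
    proof eventually_elim
      case (elim t)
      then have "r (\<phi> t u) = (\<psi> t (p u), \<psi> t (q u))" using ep eq u by (simp add: r_def)
      moreover have "\<phi> t u \<in> topspace X" using X.element_image elim u by blast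
      ultimately show ?case by (metis image_eqI)
    qed
  qed (use F in simp)
  then obtain w where w: "w \<in> topspace X" "p w = q w" by (auto simp: r_def)
  define E where "E = {x \<in> topspace X. p x = q x}"
  have "closedin X E" unfolding E_def
    by (rule closedin_continuous_maps_eq[OF Y.Hausdorff_phase_space cp cq])
  moreover have "orbit G \<phi> w \<subseteq> E"
    using X.element_image w ep eq by (auto simp: orbit_def E_def)
  ultimately have "X closure_of orbit G \<phi> w \<subseteq> E" by (rule closure_of_minimal[rotated])
  then show ?thesis using min w x by (auto simp: minimal_flow_def E_def)
qed

section \<open>Topological automorphisms and inner automorphisms\<close>

lemma Aut_inverse:
  assumes "group G" and top: "topspace T = carrier G" and a: "a \<in> Aut G T"
  obtains b where "b \<in> Aut G T" "\<And>t. t \<in> carrier G \<Longrightarrow> a (b t) = t"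
    "\<And>t. t \<in> carrier G \<Longrightarrow> b (a t) = t"
proof -
  interpret group G by fact
  \<comment> \<open>The restriction makes \<open>b\<close> extensional, as membership in
    \<open>auto G\<close> demands; the topological inverse \<open>g\<close> below agrees with it on
    \<open>carrier G\<close>.\<close>
  define b where "b = restrict (inv_into (carrier G) a) (carrier G)"
  have aB: "a \<in> auto G" "homeomorphic_map T T a" using a by (auto simp: Aut_def)
  then have bij: "bij_betw a (carrier G) (carrier G)" by (auto simp: auto_def Bij_def)
  then have ab: "a (b t) = t" "b (a t) = t" "b t \<in> carrier G" if "t \<in> carrier G" for t
    using that bij_betw_inv_into_right[OF bij] bij_betw_inv_into_left[OF bij]
      bij_betwE[OF bij] bij_betwE[OF bij_betw_inv_into[OF bij]] by (auto simp: b_def)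
  have "b \<in> hom G G" "b \<in> Bij (carrier G)" unfolding b_def
    using aB restrict_inv_into_hom restrict_inv_into_Bij by (auto simp: auto_def)
  moreover have "homeomorphic_map T T b"
  proof -
    obtain g where g: "homeomorphic_maps T T a g" using aB homeomorphic_map_maps by blast
    then have "homeomorphic_map T T g" using homeomorphic_maps_map by blast
    moreover have "g t = b t" if "t \<in> topspace T" for t
      using g ab[of t] that top unfolding homeomorphic_maps_def by metis
    ultimately show ?thesis by (rule homeomorphic_map_eq)
  qed
  ultimately show thesis using that ab by (auto simp: Aut_def auto_def)
qed

text \<open>Conjugation by the inverse of \<open>t\<close> is a continuous two-sided inverse, so
  only continuity of conjugation has to be extracted from that of division.\<close>

lemma inner_aut_in_Aut:
  assumes "topological_group G T" and t: "t \<in> carrier G"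
  shows "inner_aut G t \<in> Aut G T"
proof -
  interpret topological_group G T by fact
  have hom: "inner_aut G s \<in> hom G G" if "s \<in> carrier G" for s
    using that by (auto intro!: homI simp: inner_aut_def m_assoc inv_solve_left)
  have inv: "inner_aut G s (inner_aut G (inv\<^bsub>G\<^esub> s) g) = g"
    if "s \<in> carrier G" "g \<in> carrier G" for s g
    using that by (simp add: inner_aut_def m_assoc inv_solve_left) (simp add: m_assoc[symmetric])
  have inv': "inner_aut G (inv\<^bsub>G\<^esub> s) (inner_aut G s g) = g"
    if "s \<in> carrier G" "g \<in> carrier G" for s g
    using inv[of "inv\<^bsub>G\<^esub> s" g] that by simp
  \<comment> \<open>Inversion is division with the first argument fixed at the neutral
    element.\<close>
  have cinv: "continuous_map T T (\<lambda>g. inv\<^bsub>G\<^esub> g)"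
  proof -
    have "continuous_map T (prod_topology T T) (\<lambda>g. (\<one>\<^bsub>G\<^esub>, g))"
      by (intro continuous_map_pairedI) (simp_all add: topspace_eq_carrier)
    from continuous_map_compose[OF this continuous_mult_inv]
    show ?thesis by (rule continuous_map_eq) (simp add: topspace_eq_carrier)
  qed
  have cmul: "continuous_map T T (\<lambda>g. f g \<otimes>\<^bsub>G\<^esub> inv\<^bsub>G\<^esub> (h g))"
    if "continuous_map T T f" "continuous_map T T h" for f h
    using continuous_map_compose[OF continuous_map_pairedI[OF that] continuous_mult_inv]
    by (simp add: o_def)
  have cont: "continuous_map T T (inner_aut G s)" if s: "s \<in> carrier G" for s
  proof -
    \<comment> \<open>The double inverse writes the product of \<open>s\<close> and \<open>g\<close>
      as a quotient, the form that \<open>cmul\<close> handles.\<close>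
    have "continuous_map T T (\<lambda>g. s \<otimes>\<^bsub>G\<^esub> inv\<^bsub>G\<^esub> (inv\<^bsub>G\<^esub> g) \<otimes>\<^bsub>G\<^esub> inv\<^bsub>G\<^esub> s)"
      by (intro cmul cinv) (simp_all add: topspace_eq_carrier s)
    then show ?thesis
      by (rule continuous_map_eq) (simp add: topspace_eq_carrier inner_aut_def)
  qed
  have maps: "inner_aut G s \<in> carrier G \<rightarrow> carrier G" if "s \<in> carrier G" for s
    using hom[OF that] by (auto simp: hom_def)
  have "bij_betw (inner_aut G t) (carrier G) (carrier G)"
    by (rule bij_betw_byWitness[where f' = "inner_aut G (inv\<^bsub>G\<^esub> t)"])
      (use t inv inv' maps[OF t] maps[of "inv\<^bsub>G\<^esub> t"] in auto)
  moreover have "homeomorphic_maps T T (inner_aut G t) (inner_aut G (inv\<^bsub>G\<^esub> t))"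
    using cont t inv inv' by (simp add: homeomorphic_maps_def topspace_eq_carrier)
  ultimately show ?thesis
    using hom[OF t] homeomorphic_maps_map
    by (auto simp: Aut_def auto_def Bij_def inner_aut_def)
qed

text \<open>Two elements \<open>s\<close>, \<open>t\<close> with the same conjugation differ by the
  central factor \<open>c\<close>, the product of the inverse of \<open>t\<close> with
  \<open>s\<close>; this is where the trivial center enters.\<close>

lemma inner_aut_inj_on:
  assumes "group G"
    and center: "{t \<in> carrier G. \<forall>g\<in>carrier G. t \<otimes>\<^bsub>G\<^esub> g = g \<otimes>\<^bsub>G\<^esub> t} = {\<one>\<^bsub>G\<^esub>}"
  shows "inj_on (inner_aut G) (carrier G)"
proof (rule inj_onI)
  interpret group G by fact
  fix s t assume st: "s \<in> carrier G" "t \<in> carrier G" "inner_aut G s = inner_aut G t"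
  define c where "c = inv\<^bsub>G\<^esub> t \<otimes>\<^bsub>G\<^esub> s"
  have c: "c \<in> carrier G" using st by (simp add: c_def)
  have "c \<otimes>\<^bsub>G\<^esub> g = g \<otimes>\<^bsub>G\<^esub> c" if g: "g \<in> carrier G" for g
  proof -
    have "s \<otimes>\<^bsub>G\<^esub> g \<otimes>\<^bsub>G\<^esub> inv\<^bsub>G\<^esub> s = t \<otimes>\<^bsub>G\<^esub> g \<otimes>\<^bsub>G\<^esub> inv\<^bsub>G\<^esub> t"
      using fun_cong[OF st(3), of g] g by (simp add: inner_aut_def)
    then have "s \<otimes>\<^bsub>G\<^esub> g = t \<otimes>\<^bsub>G\<^esub> g \<otimes>\<^bsub>G\<^esub> inv\<^bsub>G\<^esub> t \<otimes>\<^bsub>G\<^esub> s"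
      using st g by (metis inv_closed inv_solve_right' m_closed inv_inv)
    then have "s \<otimes>\<^bsub>G\<^esub> g = t \<otimes>\<^bsub>G\<^esub> (g \<otimes>\<^bsub>G\<^esub> c)"
      using st g by (simp add: c_def m_assoc)
    then show ?thesis using st g c unfolding c_def
      by (metis inv_closed inv_solve_left' m_assoc m_closed)
  qed
  then have "c = \<one>\<^bsub>G\<^esub>" using center c by blast
  then show "s = t" using st unfolding c_def
    by (metis inv_closed inv_equality inv_inv inv_comm)
qed

section \<open>Twisting a flow by an automorphism\<close>

text \<open>An automorphism permutes \<open>carrier G\<close>, so the twisted orbits are the old
  ones, and nets in \<open>G\<close> are reparametrized by its inverse. The twist thereby becomes a
  target for the universal property of \<open>P\<close>.\<close>

lemma minimal_proximal_flow_twist: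
  assumes mp: "minimal_proximal_flow G T P \<pi>" and a: "a \<in> Aut G T"
  shows "minimal_proximal_flow G T P (\<lambda>t. \<pi> (a t))"
proof -
  interpret flow G T P \<pi>
    using mp by (simp add: minimal_proximal_flow_def minimal_flow_def)
  obtain b where b: "b \<in> Aut G T" "\<And>t. t \<in> carrier G \<Longrightarrow> a (b t) = t"
    "\<And>t. t \<in> carrier G \<Longrightarrow> b (a t) = t"
    using Aut_inverse[OF is_group topspace_eq_carrier a] by blast
  have ah: "a \<in> hom G G" and ca: "continuous_map T T a"
    using a by (auto simp: Aut_def auto_def homeomorphic_imp_continuous_map)
  have mapsto: "a t \<in> carrier G" "b t \<in> carrier G" if "t \<in> carrier G" for t
    using a b(1) that by (auto simp: Aut_def auto_def hom_def)
  have "flow G T P (\<lambda>t. \<pi> (a t))"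
    unfolding flow_def flow_axioms_def
  proof (intro conjI)
    show "topological_group G T" by (rule topological_group_axioms)
    show "group_action G (topspace P) (\<lambda>t. \<pi> (a t))"
      using ah group_hom.homh[OF group_hom] group_BijGroup is_group
      unfolding group_action_def group_hom_def group_hom_axioms_def
      by (auto simp: hom_def Pi_iff)
    have "continuous_map (prod_topology T P) (prod_topology T P) (\<lambda>p. (a (fst p), snd p))"
      using continuous_map_compose[OF continuous_map_fst ca]
      by (intro continuous_map_pairedI) (auto simp: o_def continuous_map_snd)
    from continuous_map_compose[OF this continuous_action]
    show "continuous_map (prod_topology T P) P (\<lambda>(t, x). \<pi> (a t) x)"
      by (simp add: o_def case_prod_unfold)
  qed (use nonempty_space compact_phase_space Hausdorff_phase_space in auto)
  moreover have "orbit G (\<lambda>t. \<pi> (a t)) x = orbit G \<pi> x" for x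
    using mapsto b(2) unfolding orbit_def by (auto; metis)
  moreover have "proximal G P (\<lambda>t. \<pi> (a t))"
    unfolding proximal_def
  proof (intro ballI)
    fix x y assume "x \<in> topspace P" "y \<in> topspace P"
    then obtain F z where F: "F \<noteq> bot" "\<forall>\<^sub>F t in F. t \<in> carrier G"
      "limitin P (\<lambda>t. \<pi> t x) z F" "limitin P (\<lambda>t. \<pi> t y) z F"
      using mp unfolding minimal_proximal_flow_def proximal_def by blast
    \<comment> \<open>Moving the net by \<open>b\<close> cancels the twist, since
      \<open>a (b t) = t\<close>; the limits stay the same.\<close>
    have "limitin P (\<lambda>t. \<pi> (a t) w) z (filtermap b F)" if "limitin P (\<lambda>t. \<pi> t w) z F" for w
    proof -
      have "limitin P (\<lambda>t. \<pi> (a (b t)) w) z F"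
        by (rule limitin_transform_eventually[OF _ that])
          (use F(2) in eventually_elim, simp add: b(2))
      then show ?thesis by (simp add: limitin_def eventually_filtermap)
    qed
    moreover have "\<forall>\<^sub>F t in filtermap b F. t \<in> carrier G"
      unfolding eventually_filtermap using F(2) by eventually_elim (rule mapsto)
    moreover have "filtermap b F \<noteq> bot" using F(1) by (simp add: filtermap_bot_iff)
    ultimately show "\<exists>F z. F \<noteq> bot \<and> (\<forall>\<^sub>F t in F. t \<in> carrier G) \<and>
        limitin P (\<lambda>t. \<pi> (a t) x) z F \<and> limitin P (\<lambda>t. \<pi> (a t) y) z F"
      using F(3,4) by blast
  qed
  ultimately show ?thesis
    using mp by (simp add: minimal_proximal_flow_def minimal_flow_def)
qed

section \<open>Existence and uniqueness of \<open>hat\<close>\<close>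

text \<open>Both \<open>h\<close> and \<open>k\<close> are equivariant from \<open>P\<close> to its
  twist by \<open>a\<close>, which is again proximal, so they agree on \<open>topspace P\<close>;
  extensionality settles the other points.\<close>

lemma twisted_equivariant_unique:
  assumes mp: "minimal_proximal_flow G T P \<pi>" and a: "a \<in> Aut G T"
    and h: "h \<in> Homeo P" "\<forall>t\<in>carrier G. \<forall>x\<in>topspace P. h (\<pi> t x) = \<pi> (a t) (h x)"
    and k: "k \<in> Homeo P" "\<forall>t\<in>carrier G. \<forall>x\<in>topspace P. k (\<pi> t x) = \<pi> (a t) (k x)"
  shows "h = k"
proof (rule extensionalityI)
  show "h \<in> extensional (topspace P)" "k \<in> extensional (topspace P)"
    using h k by (auto simp: Homeo_def Bij_def)
  fix x assume x: "x \<in> topspace P"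
  have ch: "continuous_map P P h" and ck: "continuous_map P P k"
    using h k by (auto simp: Homeo_def homeomorphic_imp_continuous_map)
  show "h x = k x"
    by (rule equivariant_maps_into_proximal_eq[where X=P and Y=P and \<phi>=\<pi> and
          \<psi>="\<lambda>t. \<pi> (a t)", OF _ _ _ ch ck _ _ x])
      (use mp minimal_proximal_flow_twist[OF mp a] h(2) k(2) in
        \<open>auto simp: minimal_proximal_flow_def minimal_flow_def\<close>)
qed

lemma hat_eqI:
  assumes "minimal_proximal_flow G T P \<pi>" "a \<in> Aut G T"
    and "h \<in> Homeo P" "\<forall>t\<in>carrier G. \<forall>x\<in>topspace P. h (\<pi> t x) = \<pi> (a t) (h x)"
  shows "hat G P \<pi> a = h"
  unfolding hat_def
  by (rule the_equality) (use assms twisted_equivariant_unique[OF assms(1,2)] in blast)+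

text \<open>Universality gives equivariant maps \<open>p\<close> and \<open>q\<close> from
  \<open>P\<close> to its twists by \<open>a\<close> and by the inverse of \<open>a\<close>. In
  either composite the twists cancel, so it is an equivariant self-map of \<open>P\<close> and
  therefore the identity.\<close>

lemma hat_properties:
  assumes univ: "universal_minimal_proximal_flow G T P \<pi>" and a: "a \<in> Aut G T"
  shows "hat G P \<pi> a \<in> Homeo P"
    "\<lbrakk>t \<in> carrier G; x \<in> topspace P\<rbrakk> \<Longrightarrow>
      hat G P \<pi> a (\<pi> t x) = \<pi> (a t) (hat G P \<pi> a x)"
proof -
  have mp: "minimal_proximal_flow G T P \<pi>"
    using univ by (simp add: universal_minimal_proximal_flow_def)
  then have min: "minimal_flow G T P \<pi>" and prox: "proximal G P \<pi>"
    by (simp_all add: minimal_proximal_flow_def)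
  then interpret flow G T P \<pi> by (simp add: minimal_flow_def)
  have closed: "\<pi> t x \<in> topspace P" if "t \<in> carrier G" "x \<in> topspace P" for t x
    using element_image that by blast
  have ex: "\<exists>p. continuous_map P P p \<and>
      (\<forall>t\<in>carrier G. \<forall>x\<in>topspace P. p (\<pi> t x) = \<pi> (c t) (p x))" if "c \<in> Aut G T" for c
    using universal_minimal_proximal_flow_factor[OF univ minimal_proximal_flow_twist[OF mp that]]
    unfolding is_factor_def by blast
  obtain b where b: "b \<in> Aut G T" "\<And>t. t \<in> carrier G \<Longrightarrow> a (b t) = t"
    "\<And>t. t \<in> carrier G \<Longrightarrow> b (a t) = t"
    using Aut_inverse[OF is_group topspace_eq_carrier a] by blast
  have mapsto: "a t \<in> carrier G" "b t \<in> carrier G" if "t \<in> carrier G" for t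
    using a b(1) that by (auto simp: Aut_def auto_def hom_def)
  obtain p where p: "continuous_map P P p"
    "\<forall>t\<in>carrier G. \<forall>x\<in>topspace P. p (\<pi> t x) = \<pi> (a t) (p x)"
    using ex[OF a] by blast
  obtain q where q: "continuous_map P P q"
    "\<forall>t\<in>carrier G. \<forall>x\<in>topspace P. q (\<pi> t x) = \<pi> (b t) (q x)"
    using ex[OF b(1)] by blast
  have pP: "p x \<in> topspace P" and qP: "q x \<in> topspace P" if "x \<in> topspace P" for x
    using p(1) q(1) that continuous_map_image_subset_topspace by fast+
  \<comment> \<open>Comparison with the identity map: \<open>P\<close> is both a minimal source and
    a proximal target.\<close>
  have endo: "r x = x" if "continuous_map P P r" "x \<in> topspace P"
    "\<And>t x. t \<in> carrier G \<Longrightarrow> x \<in> topspace P \<Longrightarrow> r (\<pi> t x) = \<pi> t (r x)" for r x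
    by (rule equivariant_maps_into_proximal_eq[where X=P and Y=P and \<phi>=\<pi> and \<psi>=\<pi> and p=r
          and q="\<lambda>x. x", OF min flow_axioms prox that(1) _ that(3) _ that(2)]) simp_all
  have qp: "q (p x) = x" if "x \<in> topspace P" for x
    using endo[of "q \<circ> p" x] that p q b mapsto pP continuous_map_compose[OF p(1) q(1)] by simp
  have pq: "p (q x) = x" if "x \<in> topspace P" for x
    using endo[of "p \<circ> q" x] that p q b mapsto qP continuous_map_compose[OF q(1) p(1)] by simp
  define h where "h = restrict p (topspace P)"
  have "homeomorphic_maps P P p q" using p q pq qp by (simp add: homeomorphic_maps_def)
  then have hp: "homeomorphic_map P P p" using homeomorphic_maps_map by blast
  then have "homeomorphic_map P P h"
    by (rule homeomorphic_map_eq) (simp add: h_def)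
  moreover from this have "bij_betw h (topspace P) (topspace P)"
    by (simp add: bij_betw_def homeomorphic_imp_injective_map homeomorphic_imp_surjective_map)
  ultimately have h: "h \<in> Homeo P" by (simp add: Homeo_def Bij_def h_def)
  have he: "\<forall>t\<in>carrier G. \<forall>x\<in>topspace P. h (\<pi> t x) = \<pi> (a t) (h x)"
    using p(2) closed by (simp add: h_def)
  have "hat G P \<pi> a = h" by (rule hat_eqI[OF mp a h he])
  with h he show "hat G P \<pi> a \<in> Homeo P"
    "\<lbrakk>t \<in> carrier G; x \<in> topspace P\<rbrakk> \<Longrightarrow>
      hat G P \<pi> a (\<pi> t x) = \<pi> (a t) (hat G P \<pi> a x)" by auto
qed

section \<open>The action as \<open>hat\<close> of inner automorphisms\<close>

lemma (in flow) action_in_Homeo: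
  assumes t: "t \<in> carrier G"
  shows "\<phi> t \<in> Homeo X"
proof -
  have cont: "continuous_map X X (\<phi> s)" if "s \<in> carrier G" for s
  proof -
    have "continuous_map X (prod_topology T X) (\<lambda>x. (s, x))"
      using that by (intro continuous_map_pairedI) (simp_all add: topspace_eq_carrier)
    from continuous_map_compose[OF this continuous_action] show ?thesis by (simp add: o_def)
  qed
  have "homeomorphic_maps X X (\<phi> t) (\<phi> (inv t))"
    using t cont orbit_sym_aux[OF t _ refl] orbit_sym_aux[OF inv_closed[OF t] _ refl]
    by (simp add: homeomorphic_maps_def)
  then have "homeomorphic_map X X (\<phi> t)" using homeomorphic_maps_map by blast
  then show ?thesis using bij_prop0[OF t] by (simp add: Homeo_def)
qed

text \<open>The identity \<open>t g = (t g inv t) t\<close> says that \<open>\<pi> t\<close>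
  satisfies the equation characterizing \<open>hat\<close> of the inner automorphism of
  \<open>t\<close>.\<close>

lemma hat_inner_aut:
  assumes mp: "minimal_proximal_flow G T P \<pi>" and t: "t \<in> carrier G"
  shows "hat G P \<pi> (inner_aut G t) = \<pi> t"
proof -
  interpret flow G T P \<pi>
    using mp by (simp add: minimal_proximal_flow_def minimal_flow_def)
  have "\<pi> t (\<pi> g x) = \<pi> (inner_aut G t g) (\<pi> t x)"
    if "g \<in> carrier G" "x \<in> topspace P" for g x
  proof -
    have "\<pi> (inner_aut G t g) (\<pi> t x) = \<pi> (inner_aut G t g \<otimes>\<^bsub>G\<^esub> t) x"
      using that t composition_rule[of x "inner_aut G t g" t] by (simp add: inner_aut_def)
    also have "inner_aut G t g \<otimes>\<^bsub>G\<^esub> t = t \<otimes>\<^bsub>G\<^esub> g"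
      using that t by (simp add: inner_aut_def m_assoc)
    also have "\<pi> (t \<otimes>\<^bsub>G\<^esub> g) x = \<pi> t (\<pi> g x)"
      using that t composition_rule by simp
    finally show ?thesis ..
  qed
  then show ?thesis
    by (intro hat_eqI[OF mp inner_aut_in_Aut[OF topological_group_axioms t]
          action_in_Homeo[OF t]]) blast
qed

section \<open>Effectiveness, factors and injectivity of \<open>hat\<close>\<close>

text \<open>A homomorphism is injective iff its kernel is trivial. Since each
  \<open>\<phi> t\<close> is extensional, acting trivially on \<open>topspace X\<close> amounts to
  \<open>\<phi> t = \<phi> \<one>\<close>.\<close>

lemma (in flow) effective_iff_inj_on: "effective G X \<phi> \<longleftrightarrow> inj_on \<phi> (carrier G)"
proof
  assume eff: "effective G X \<phi>"
  show "inj_on \<phi> (carrier G)"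
  proof (rule inj_onI)
    fix s t assume st: "s \<in> carrier G" "t \<in> carrier G" "\<phi> s = \<phi> t"
    have "\<phi> (inv t \<otimes> s) x = x" if "x \<in> topspace X" for x
      using st that composition_rule[of x "inv t" s] orbit_sym_aux[OF st(2) that refl] by simp
    then have "inv t \<otimes> s = \<one>" using eff st by (simp add: effective_def)
    then show "s = t" using st
      by (metis inv_closed inv_equality inv_inv inv_comm)
  qed
next
  assume inj: "inj_on \<phi> (carrier G)"
  have one: "\<phi> \<one> x = x" if "x \<in> topspace X" for x
    using that id_eq_one by (metis restrict_apply')
  have "t = \<one>" if t: "t \<in> carrier G" "\<forall>x\<in>topspace X. \<phi> t x = x" for t
  proof -
    have "\<phi> t = \<phi> \<one>"
    proof (rule extensionalityI)
      show "\<phi> t \<in> extensional (topspace X)" "\<phi> \<one> \<in> extensional (topspace X)"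
        using bij_prop0 t(1) by (auto simp: Bij_def)
    qed (use t one in simp)
    then show ?thesis using inj t(1) by (simp add: inj_on_eq_iff)
  qed
  then show "effective G X \<phi>" by (simp add: effective_def)
qed

text \<open>An element that fixes every point of \<open>X\<close> also fixes every point of the
  image under the surjective factor map.\<close>

lemma effective_factor:
  assumes fl: "flow G T X \<phi>" and fac: "is_factor G Y \<psi> X \<phi>" and eff: "effective G Y \<psi>"
  shows "effective G X \<phi>"
proof -
  obtain p where p: "p ` topspace X = topspace Y"
    "\<forall>t\<in>carrier G. \<forall>x\<in>topspace X. p (\<phi> t x) = \<psi> t (p x)"
    using fac unfolding is_factor_def by blast
  have "\<psi> t y = y" if "t \<in> carrier G" "\<forall>x\<in>topspace X. \<phi> t x = x" "y \<in> topspace Y" for t y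
    using p that by (metis imageE)
  then show ?thesis using eff unfolding effective_def by blast
qed

text \<open>If \<open>h\<close> is the common value, then
  \<open>\<pi> (a t) (h x) = h (\<pi> t x) = \<pi> (b t) (h x)\<close>. As \<open>h\<close> is onto,
  \<open>a t\<close> and \<open>b t\<close> act alike, and effectiveness identifies them.\<close>

lemma hat_inj_on_if_effective:
  assumes univ: "universal_minimal_proximal_flow G T P \<pi>" and eff: "effective G P \<pi>"
  shows "inj_on (hat G P \<pi>) (Aut G T)"
proof (rule inj_onI)
  interpret flow G T P \<pi>
    using univ by (simp add: universal_minimal_proximal_flow_def minimal_proximal_flow_def
        minimal_flow_def)
  fix a b assume ab: "a \<in> Aut G T" "b \<in> Aut G T" "hat G P \<pi> a = hat G P \<pi> b"
  define h where "h = hat G P \<pi> a"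
  have surj: "h ` topspace P = topspace P"
    using hat_properties(1)[OF univ ab(1)]
    by (auto simp: h_def Homeo_def Bij_def bij_betw_def)
  show "a = b"
  proof (rule extensionalityI)
    show "a \<in> extensional (carrier G)" "b \<in> extensional (carrier G)"
      using ab by (auto simp: Aut_def auto_def Bij_def)
    fix t assume t: "t \<in> carrier G"
    have car: "a t \<in> carrier G" "b t \<in> carrier G"
      using ab t by (auto simp: Aut_def auto_def hom_def)
    have "\<pi> (a t) = \<pi> (b t)"
    proof (rule extensionalityI)
      show "\<pi> (a t) \<in> extensional (topspace P)" "\<pi> (b t) \<in> extensional (topspace P)"
        using bij_prop0 car by (auto simp: Bij_def)
      fix y assume "y \<in> topspace P"
      then obtain x where x: "x \<in> topspace P" "y = h x" using surj by blast
      then show "\<pi> (a t) y = \<pi> (b t) y"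
        using hat_properties(2)[OF univ ab(1) t x(1)] hat_properties(2)[OF univ ab(2) t x(1)]
          ab(3) by (simp add: h_def)
    qed
    then show "a t = b t" using eff car by (simp add: effective_iff_inj_on inj_on_eq_iff)
  qed
qed

theorem theorem2p3:
  fixes G :: "('g, 'r) monoid_scheme" and T :: "'g topology"
    and P :: "'p topology" and \<pi> :: "'g \<Rightarrow> 'p \<Rightarrow> 'p"
  assumes "topological_group G T"
    and "{t \<in> carrier G. \<forall>g\<in>carrier G. t \<otimes>\<^bsub>G\<^esub> g = g \<otimes>\<^bsub>G\<^esub> t} = {\<one>\<^bsub>G\<^esub>}"
    and "universal_minimal_proximal_flow G T P \<pi>"
  shows "(effective G P \<pi> \<longleftrightarrow>
           inj_on (\<lambda>t. hat G P \<pi> (inner_aut G t)) (carrier G)) \<and>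
         (inj_on (\<lambda>t. hat G P \<pi> (inner_aut G t)) (carrier G) \<longleftrightarrow>
           inj_on (hat G P \<pi>) (Aut G T)) \<and>
         (effective G P \<pi> \<longleftrightarrow>
           inj_on (hat G P \<pi>) (Aut G T)) \<and>
         (effective G P \<pi> \<or>
           inj_on (\<lambda>t. hat G P \<pi> (inner_aut G t)) (carrier G) \<or>
           inj_on (hat G P \<pi>) (Aut G T) \<longrightarrow>
           (\<forall>(M :: 'm topology) \<mu>. universal_minimal_flow G T M \<mu> \<longrightarrow> effective G M \<mu>))"
proof -
  have mp: "minimal_proximal_flow G T P \<pi>"
    using assms(3) by (simp add: universal_minimal_proximal_flow_def)
  then have min: "minimal_flow G T P \<pi>" by (simp add: minimal_proximal_flow_def)
  then interpret flow G T P \<pi> by (simp add: minimal_flow_def)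
  have "inj_on (\<lambda>t. hat G P \<pi> (inner_aut G t)) (carrier G) \<longleftrightarrow> inj_on \<pi> (carrier G)"
    by (rule inj_on_cong) (rule hat_inner_aut[OF mp])
  then have 12: "effective G P \<pi> \<longleftrightarrow> inj_on (\<lambda>t. hat G P \<pi> (inner_aut G t)) (carrier G)"
    by (simp add: effective_iff_inj_on)
  have 13: "inj_on (hat G P \<pi>) (Aut G T)" if "effective G P \<pi>"
    by (rule hat_inj_on_if_effective[OF assms(3) that])
  \<comment> \<open>The map in question is \<open>hat\<close> after \<open>inner_aut\<close>, a
    composite of two injections.\<close>
  have 32: "inj_on (\<lambda>t. hat G P \<pi> (inner_aut G t)) (carrier G)"
    if "inj_on (hat G P \<pi>) (Aut G T)"
  proof -
    have "inner_aut G ` carrier G \<subseteq> Aut G T"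
      using inner_aut_in_Aut[OF assms(1)] by blast
    then show ?thesis
      using comp_inj_on[OF inner_aut_inj_on[OF is_group assms(2)] inj_on_subset[OF that]]
      by (simp add: o_def)
  qed
  \<comment> \<open>\<open>P\<close> is itself a minimal flow, hence a factor of \<open>M\<close>,
    and effectiveness lifts from factors.\<close>
  have "effective G M \<mu>" if "effective G P \<pi>" "universal_minimal_flow G T M \<mu>"
    for M :: "'m topology" and \<mu>
  proof (rule effective_factor[OF _ universal_minimal_flow_factor[OF that(2) min] that(1)])
    show "flow G T M \<mu>" using that(2) by (simp add: universal_minimal_flow_def minimal_flow_def)
  qed
  then show ?thesis using 12 13 32 by blast
qed

end
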